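(* Let $\widehat W\in\mathbb{R}^{n\times n}$ be symmetric with eigenvalues $\lambda_1\ge\cdots\ge\lambda_n\ge0$, let $E\in\mathbb{R}^{n\times n}$ be symmetric and nonzero, and let $\widetilde W=\widehat W+E$ have eigenvalues $\widetilde\lambda_1\ge\cdots\ge\widetilde\lambda_n$. Write $\mu_i=(\widetilde\lambda_i)_+=\max\{\widetilde\lambda_i,0\}$. Fix $L\in[n]$ with $L+1\le n$, $\lambda_{L+1}>0$ and $\mu_{L+1}>0$. Let $\varepsilon\in(0,1)$, $\varepsilon'\in(0,\frac13)$, $\alpha>0$, $\eta>0$ satisfy $\alpha^2<\varepsilon'\min\{\lambda_{L+1},\mu_{L+1}\}$ and $\eta<\big[4\max\{1,\lambda_1,\mu_1\}\big]^{-1}$. Assume that both sequences $(\lambda_1,\dots,\lambda_{L+1})$ and $(\mu_1,\dots,\mu_{L+1})$ satisfy the spectral conditions (S) described in the context. Let $$T_0=T_0(\lambda_1,\dots,\lambda_L),\quad T_1=T_1(\lambda_{L+1}),\quad \widetilde T_0=T_0(\mu_1,\dots,\mu_L),\quad \widetilde T_1=T_1(\mu_{L+1})$$ with the functions $T_0(\cdot)$, $T_1(\cdot)$ defined in the context. Assume further that $$\lambda_{L+1}-\|E\|>\alpha^2,\qquad 0<\tfrac23\eta\left(\lambda_{L+1}+\|E\|\right)<1.$$ Then $$\left|\widetilde T_1-T_1\right|<\frac{\|E\|}{2\eta(\lambda_{L+1}-\|E\|)}\left(\frac1{\lambda_{L+1}-\|E\|-\alpha^2}+\frac{|H(\lambda_{L+1})-C_{\varepsilon'}|}{\lambda_{L+1}}\right)$$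 and $$\begin{aligned}\left|\widetilde T_0-T_0\right|<{}&\frac{\|E\|}{2\eta(\lambda_{L+1}-\|E\|)}\left(\frac1{\lambda_{L+1}-\|E\|-\alpha^2}+\frac{|H(\lambda_{L+1})-C_2|}{\lambda_{L+1}}\right)\\&+\frac{\|E\|}{\sqrt3\,\alpha}\,\frac1{\sqrt{\lambda_{L+1}-\|E\|}+\sqrt{\lambda_{L+1}}}\\&+\frac{9K_\varepsilon\|E\|}{2\eta\lambda_{L+1}(\lambda_{L+1}-\|E\|)\,\left|3-2\eta(\lambda_{L+1}+\|E\|)\right|}+1,\end{aligned}$$ where $H(\lambda)=\ln\left(\frac{\lambda}{\alpha^2}-1\right)$, $C_{\varepsilon'}=\ln\left(\frac1{\varepsilon'}-1\right)$, $C_2=\ln2$, and $K_\varepsilon=\ln\frac8\varepsilon-\left|\ln\left(1-\sqrt{1/3}\right)\right|$.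
   Context: Notation: $[n]=\{1,\dots,n\}$; $\|E\|$ is the spectral norm. $\alpha$ is the initialization scale and $\eta$ the step size of gradient descent for two-factor matrix factorization; $[T_0,T_1]$ and $[\widetilde T_0,\widetilde T_1]$ are the low-rank intervals for the target matrices $\widehat W$ and $\widetilde W$. For $\lambda>\alpha^2$ and $\rho>0$ define $$T_2^{\mathrm{Id}}(\lambda,\rho,\alpha,\eta)=\frac1{2\eta\lambda}\left[\ln\left(\frac\lambda{\alpha^2}-1\right)-\ln2\right]+\left\lceil\sqrt{\frac\lambda3}\,\frac1\alpha\right\rceil+\frac{\ln(\sqrt\lambda/\rho)-|\ln(1-\sqrt{1/3})|}{|\ln(1-2\eta\lambda/3)|}.$$ For $\nu_1\ge\cdots\ge\nu_{L+1}>\alpha^2$ define $$T_0(\nu_1,\dots,\nu_L)=\max\left\{T_2^{\mathrm{Id}}\left(\nu_1,\tfrac{\nu_1}2,\alpha,\eta\right),\ \max_{\ell\in[L]}T_2^{\mathrm{Id}}\left(\nu_\ell,\tfrac{\sqrt{\nu_\ell}}8\varepsilon,\alpha,\eta\right)\right\},$$ $$T_1(\nu_{L+1})=\frac1{2\eta\nu_{L+1}}\left[\ln\left(\frac{\nu_{L+1}}{\alpha^2}-1\right)-\ln\left(\frac1{\varepsilon'}-1\right)\right].$$ Spectral conditions (S) for a sequence $\nu_1\ge\cdots\ge\nu_{L+1}>0$ (with $K_\varepsilon$ as in the claim): (i) $\nu_1\ge1$ and $\nu_L\ge2(e+1)\alpha^2$; (ii) for all $\ell\in[L-1]$, $$\nu_\ell-\nu_{\ell+1}\ge\frac{3\left(1-\frac23\eta\nu_{\ell+1}\right)\left(\ln\left(1-\frac23\eta\nu_\ell\right)\right)^2}{2\eta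 K_\varepsilon}\left(\left\lceil\sqrt{\frac{\nu_\ell}{3}}\,\frac1\alpha\right\rceil-\left\lceil\sqrt{\frac{\nu_{\ell+1}}{3}}\,\frac1\alpha\right\rceil\right);$$ (iii) $\nu_L>\nu_{L+1}$ and $$\alpha<\exp\left(\frac{1}{2(\nu_L-\nu_{L+1})}\Big(\nu_L\ln(\varepsilon'\nu_{L+1})-\nu_{L+1}\big(\ln\nu_L-\ln2-3K_\varepsilon\big)\Big)\right);$$ (iv) $$\eta<\frac{\frac1{\nu_{L+1}}\left[\ln\left(\frac{\nu_{L+1}}{\alpha^2}-1\right)-\ln\left(\frac1{\varepsilon'}-1\right)\right]-\frac1{\nu_L}\left[\ln\left(\frac{\nu_L}{\alpha^2}-1\right)-\ln2-3K_\varepsilon\right]}{2\left\lceil\sqrt{\frac{\nu_L}{3}}\,\frac1\alpha\right\rceil}.$$ *)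

theory Defs
  imports "HOL-Analysis.Analysis" "HOL-Computational_Algebra.Polynomial"
begin

definition symmetric_mat :: "real^'n^'n \<Rightarrow> bool" where
  "symmetric_mat A \<longleftrightarrow> transpose A = A"

definition spectral_norm :: "real^'n^'n \<Rightarrow> real" where
  "spectral_norm A = onorm (\<lambda>x. A *v x)"

definition charpoly :: "real^'n^'n \<Rightarrow> real poly" where
  "charpoly A = det (mat [:0, 1:] - (\<chi> i j. [:A $ i $ j:]))"

text \<open>
  \<open>ordered_eigenvalues A lam\<close>: the numbers \<open>lam 1 \<ge> \<dots> \<ge> lam n\<close>, where \<open>n = CARD('n)\<close>,
  are the eigenvalues of \<open>A\<close> listed with multiplicity as roots of the characteristic polynomial.
  The values of \<open>lam\<close> outside \<open>{1..n}\<close> are irrelevant.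
\<close>
definition ordered_eigenvalues :: "real^'n^'n \<Rightarrow> (nat \<Rightarrow> real) \<Rightarrow> bool" where
  "ordered_eigenvalues A lam \<longleftrightarrow>
     (\<forall>i\<in>{1..<CARD('n)}. lam (Suc i) \<le> lam i) \<and>
     charpoly A = (\<Prod>i\<in>{1..CARD('n)}. [:- lam i, 1:])"

definition K :: "real \<Rightarrow> real" where
  "K \<epsilon> = ln (8 / \<epsilon>) - \<bar>ln (1 - sqrt (1 / 3))\<bar>"

definition H :: "real \<Rightarrow> real \<Rightarrow> real" where
  "H \<alpha> x = ln (x / \<alpha>^2 - 1)"

definition ceil_steps :: "real \<Rightarrow> real \<Rightarrow> real" where
  "ceil_steps \<alpha> x = real_of_int \<lceil>sqrt (x / 3) * (1 / \<alpha>)\<rceil>"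

definition T2_Id :: "real \<Rightarrow> real \<Rightarrow> real \<Rightarrow> real \<Rightarrow> real" where
  "T2_Id x \<rho> \<alpha> \<eta> =
     1 / (2 * \<eta> * x) * (H \<alpha> x - ln 2)
     + ceil_steps \<alpha> x
     + (ln (sqrt x / \<rho>) - \<bar>ln (1 - sqrt (1 / 3))\<bar>) / \<bar>ln (1 - 2 * \<eta> * x / 3)\<bar>"

text \<open>
  The end points of the low-rank interval for a sequence \<open>\<nu> 1 \<ge> \<dots> \<ge> \<nu> (L + 1) > \<alpha>\<^sup>2\<close>;
  \<open>T0_fun\<close> only uses \<open>\<nu> 1, \<dots>, \<nu> L\<close> (with \<open>L \<ge> 1\<close>).
\<close>
definition T0_fun :: "real \<Rightarrow> real \<Rightarrow> real \<Rightarrow> nat \<Rightarrow> (nat \<Rightarrow> real) \<Rightarrow> real" where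
  "T0_fun \<alpha> \<eta> \<epsilon> L \<nu> =
     max (T2_Id (\<nu> 1) (\<nu> 1 / 2) \<alpha> \<eta>)
         (MAX l\<in>{1..L}. T2_Id (\<nu> l) (sqrt (\<nu> l) / 8 * \<epsilon>) \<alpha> \<eta>)"

definition T1_fun :: "real \<Rightarrow> real \<Rightarrow> real \<Rightarrow> real \<Rightarrow> real" where
  "T1_fun \<alpha> \<eta> \<epsilon>' x = 1 / (2 * \<eta> * x) * (H \<alpha> x - ln (1 / \<epsilon>' - 1))"

text \<open>
  The spectral conditions on \<open>\<nu> 1, \<dots>, \<nu> (L + 1)\<close>. That the sequence is nonincreasing and positive
  is a standing assumption on the argument and is not part of the predicate.
\<close>
definition spectral_conditions ::
  "real \<Rightarrow> real \<Rightarrow> real \<Rightarrow> real \<Rightarrow> nat \<Rightarrow> (nat \<Rightarrow> real) \<Rightarrow> bool" where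
  "spectral_conditions \<alpha> \<eta> \<epsilon> \<epsilon>' L \<nu> \<longleftrightarrow>
     (\<nu> 1 \<ge> 1 \<and> \<nu> L \<ge> 2 * (exp 1 + 1) * \<alpha>^2) \<and>
     (\<forall>l\<in>{1..<L}.
        \<nu> l - \<nu> (l + 1) \<ge>
          3 * (1 - 2 / 3 * \<eta> * \<nu> (l + 1)) * (ln (1 - 2 / 3 * \<eta> * \<nu> l))^2 / (2 * \<eta> * K \<epsilon>)
          * (ceil_steps \<alpha> (\<nu> l) - ceil_steps \<alpha> (\<nu> (l + 1)))) \<and>
     (\<nu> L > \<nu> (L + 1) \<and>
      \<alpha> < exp (1 / (2 * (\<nu> L - \<nu> (L + 1)))
               * (\<nu> L * ln (\<epsilon>' * \<nu> (L + 1))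
                  - \<nu> (L + 1) * (ln (\<nu> L) - ln 2 - 3 * K \<epsilon>)))) \<and>
     \<eta> < (1 / \<nu> (L + 1) * (H \<alpha> (\<nu> (L + 1)) - ln (1 / \<epsilon>' - 1))
          - 1 / \<nu> L * (H \<alpha> (\<nu> L) - ln 2 - 3 * K \<epsilon>))
         / (2 * ceil_steps \<alpha> (\<nu> L))"

end

theory Submission
  imports Defs
begin

text \<open>
  Weyl's inequality gives \<open>\<bar>\<mu>\<^sub>i - \<lambda>\<^sub>i\<bar> \<le> \<parallel>E\<parallel>\<close> for \<open>i = L, L + 1\<close>, which bounds the change of \<open>T\<^sub>1\<close>
  directly. Conditions (i) and (ii) make \<open>\<nu> \<mapsto> T\<^sub>2(\<nu>, \<epsilon> \<surd>\<nu> / 8)\<close> grow along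
  \<open>\<nu>\<^sub>1 \<ge> \<dots> \<ge> \<nu>\<^sub>L\<close>, so the maximum in \<open>T\<^sub>0\<close> is attained at \<open>\<nu>\<^sub>L\<close>, and the three summands of \<open>T\<^sub>2\<close>
  are compared at \<open>\<lambda>\<^sub>L\<close> and \<open>\<mu>\<^sub>L\<close>. The claimed bound involves \<open>\<lambda>\<^sub>L\<^sub>+\<^sub>1\<close> instead of \<open>\<lambda>\<^sub>L\<close>; passing from one
  to the other uses monotonicity of each bound in the eigenvalue, except for the logarithmic summand
  when \<open>\<lambda>\<^sub>L\<^sub>+\<^sub>1 < 2(e + 1)\<alpha>\<^sup>2\<close>, where a derivative estimate takes its place.
\<close>

subsection \<open>Weyl's inequality for symmetric matrices\<close>

text \<open>This is the first-order condition at the minimum \<open>t = 0\<close>. It will turn the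
  maximality of a Rayleigh quotient into an eigenvector equation.\<close>

lemma quadratic_nonneg_imp_linear_coeff_zero:
  fixes a b :: real
  assumes "\<And>t. 0 \<le> 2 * t * a + t\<^sup>2 * b"
  shows "a = 0"
proof (rule ccontr)
  assume "a \<noteq> 0"
  have "b \<ge> 0"
    using assms[of 1] assms[of "-1"] by simp
  \<comment> \<open>The minimiser would be \<open>- a / b\<close>; using \<open>b + 1\<close> avoids
    division by zero and still gives the negative value
    \<open>- (t\<^sup>2 * (b + 2))\<close>.\<close>
  define t where "t = - a / (b + 1)"
  have a: "a = - t * (b + 1)" and "t \<noteq> 0"
    using \<open>b \<ge> 0\<close> \<open>a \<noteq> 0\<close> by (auto simp: t_def)
  have "2 * t * a + t\<^sup>2 * b = - (t\<^sup>2 * (b + 2))"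
    by (simp add: a power2_eq_square algebra_simps)
  also have "\<dots> < 0"
    using \<open>b \<ge> 0\<close> \<open>t \<noteq> 0\<close> by simp
  finally show False
    using assms[of t] by simp
qed

text \<open>The Rayleigh quotient attains its maximum \<open>c\<close> on the compact unit sphere of
  \<open>S\<close>, at \<open>v\<close> say. The form
  \<open>c * (y \<bullet> y) - y \<bullet> f y\<close> is then nonnegative on \<open>S\<close> and
  vanishes at \<open>v\<close>, which forces \<open>v\<close> into its kernel.\<close>

lemma self_adjoint_exists_eigenvector:
  fixes f :: "'a::euclidean_space \<Rightarrow> 'a"
  assumes lin: "linear f" and sym: "\<And>x y. f x \<bullet> y = x \<bullet> f y"
    and S: "subspace S" "f ` S \<subseteq> S" "S \<noteq> {0}"
  obtains v c where "v \<in> S" "norm v = 1" "f v = c *\<^sub>R v"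
proof -
  interpret linear f by (rule lin)
  have "0 \<in> S" using S(1) by (rule subspace_0)
  then obtain w where w: "w \<in> S" "w \<noteq> 0" using S(3) by blast
  have ne: "sphere 0 1 \<inter> S \<noteq> {}"
  proof -
    have "w /\<^sub>R norm w \<in> sphere 0 1 \<inter> S"
      using w S(1) by (simp add: subspace_mul)
    then show ?thesis by blast
  qed
  have "compact (sphere 0 1 \<inter> S)"
    using S(1) by (intro compact_Int_closed) (auto simp: closed_subspace)
  moreover have "continuous_on (sphere 0 1 \<inter> S) (\<lambda>x. x \<bullet> f x)"
    by (intro continuous_intros linear_continuous_on linear_linear[THEN iffD2] lin linear_conv_bounded_linear[THEN iffD1])
  ultimately obtain v where v: "v \<in> sphere 0 1 \<inter> S"
    and max: "\<And>y. y \<in> sphere 0 1 \<inter> S \<Longrightarrow> y \<bullet> f y \<le> v \<bullet> f v"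
    using continuous_attains_sup[OF _ ne] by blast
  define c where "c = v \<bullet> f v"
  have nv: "norm v = 1" "v \<in> S" "v \<bullet> v = 1" using v by (auto simp: norm_eq_1)
  have psd: "0 \<le> c * (y \<bullet> y) - y \<bullet> f y" if "y \<in> S" for y
  proof (cases "y = 0")
    case False
    have "(y /\<^sub>R norm y) \<bullet> f (y /\<^sub>R norm y) \<le> c"
      unfolding c_def using False that S(1) by (intro max) (auto simp: subspace_mul)
    then have "(y \<bullet> f y) / (norm y * norm y) \<le> c"
      by (simp add: scale field_simps)
    with False show ?thesis
      by (simp add: dot_square_norm power2_eq_square pos_divide_le_eq)
  qed (simp add: zero)
  have orth: "c * (v \<bullet> y) - v \<bullet> f y = 0" if "y \<in> S" for y
  proof (rule quadratic_nonneg_imp_linear_coeff_zero[where b = "c * (y \<bullet> y) - y \<bullet> f y"])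
    fix t
    have "v + t *\<^sub>R y \<in> S"
      using that nv S(1) by (simp add: subspace_add subspace_mul)
    from psd[OF this] show "0 \<le> 2 * t * (c * (v \<bullet> y) - v \<bullet> f y) + t\<^sup>2 * (c * (y \<bullet> y) - y \<bullet> f y)"
      using sym[of v y] nv(3)
      by (simp add: add scale inner_add_left inner_add_right c_def[symmetric] power2_eq_square algebra_simps inner_commute)
  qed
  \<comment> \<open>By self-adjointness, the left side of \<open>orth\<close> at this
    \<open>y\<close> is \<open>y \<bullet> y\<close>.\<close>
  define y where "y = c *\<^sub>R v - f v"
  have "y \<in> S" using nv S by (auto simp: y_def subspace_diff subspace_mul)
  from orth[OF this] have "y \<bullet> y = 0"
    by (simp add: y_def inner_diff_left sym)
  then have "f v = c *\<^sub>R v" by (simp add: y_def)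
  with nv that show ?thesis by blast
qed

text \<open>Induction on the dimension: split off one eigenvector \<open>v\<close>; its orthogonal
  complement within \<open>S\<close> is again invariant because \<open>f\<close> is
  self-adjoint.\<close>

lemma self_adjoint_eigenbasis_subspace:
  fixes f :: "'a::euclidean_space \<Rightarrow> 'a"
  assumes lin: "linear f" and sym: "\<And>x y. f x \<bullet> y = x \<bullet> f y"
    and "subspace S" "f ` S \<subseteq> S"
  shows "\<exists>B d. pairwise orthogonal B \<and> (\<forall>b\<in>B. norm b = 1 \<and> f b = d b *\<^sub>R b) \<and> span B = S"
  using assms(3,4)
proof (induction "dim S" arbitrary: S rule: less_induct)
  case less
  show ?case
  proof (cases "S = {0}")
    case True
    then show ?thesis by (intro exI[of _ "{}"]) auto
  next
    case False
    then obtain v c where v: "v \<in> S" "norm v = 1" "f v = c *\<^sub>R v"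
      using self_adjoint_exists_eigenvector[OF lin sym less.prems] by metis
    define S' where "S' = S \<inter> {x. v \<bullet> x = 0}"
    have sub': "subspace S'"
      unfolding S'_def by (intro subspace_inter less.prems subspace_hyperplane)
    have "f ` S' \<subseteq> S'"
      using less.prems v by (auto simp: S'_def sym[symmetric])
    moreover have "v \<notin> S'" using v by (auto simp: S'_def)
    then have "S' \<subset> S" using v(1) by (auto simp only: S'_def)
    then have "dim S' < dim S"
      using sub' less.prems by (metis dim_psubset span_eq_iff)
    ultimately obtain B d where B: "pairwise orthogonal B" "span B = S'"
      "\<And>b. b \<in> B \<Longrightarrow> norm b = 1 \<and> f b = d b *\<^sub>R b"
      using less.hyps[of S'] sub' by metis
    have BS: "b \<in> B \<Longrightarrow> b \<in> S'" for b using B(2) span_base by blast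
    have "v \<notin> B" using \<open>v \<notin> S'\<close> BS by blast
    have "span (insert v B) = S"
    proof
      show "span (insert v B) \<subseteq> S"
        using BS v less.prems by (intro span_minimal) (auto simp: S'_def)
      show "S \<subseteq> span (insert v B)"
      proof
        fix x assume "x \<in> S"
        have "x - (v \<bullet> x) *\<^sub>R v \<in> S'"
          using \<open>x \<in> S\<close> v less.prems
          by (auto simp: S'_def subspace_diff subspace_mul inner_diff_right dot_square_norm)
        then have "x - (v \<bullet> x) *\<^sub>R v \<in> span B" using B by simp
        then show "x \<in> span (insert v B)"
          by (auto simp: span_insert)
      qed
    qed
    moreover have "pairwise orthogonal (insert v B)"
      using B(1) BS by (auto simp: pairwise_insert orthogonal_def S'_def inner_commute)
    moreover have "\<forall>b\<in>insert v B. norm b = 1 \<and> f b = (d(v := c)) b *\<^sub>R b"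
      using v B(3) \<open>v \<notin> B\<close> by auto
    ultimately show ?thesis by blast
  qed
qed

section \<open>Orthonormal eigenbases and the characteristic polynomial\<close>

definition eigenbasis :: "real^'n^'n \<Rightarrow> (real^'n) set \<Rightarrow> (real^'n \<Rightarrow> real) \<Rightarrow> bool" where
  "eigenbasis A B d \<longleftrightarrow>
     pairwise orthogonal B \<and> (\<forall>b\<in>B. norm b = 1 \<and> A *v b = d b *\<^sub>R b) \<and> span B = UNIV"

lemma symmetric_mat_eigenbasis:
  assumes "symmetric_mat A"
  obtains B d where "eigenbasis A B d"
proof -
  have "(A *v x) \<bullet> y = x \<bullet> (A *v y)" for x y
    using assms by (metis symmetric_mat_def dot_lmul_matrix transpose_matrix_vector)
  from self_adjoint_eigenbasis_subspace[OF matrix_vector_mul_linear this subspace_UNIV]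
  show ?thesis using that unfolding eigenbasis_def by blast
qed

lemma eigenbasis_independent:
  assumes "eigenbasis A B d"
  shows "independent B"
  using assms unfolding eigenbasis_def
  by (metis norm_zero pairwise_orthogonal_independent zero_neq_one)

lemma eigenbasis_finite:
  assumes "eigenbasis A B d"
  shows "finite B"
  using eigenbasis_independent[OF assms] by (simp add: independent_imp_finite)

lemma eigenbasis_card:
  fixes A :: "real^'n^'n"
  assumes "eigenbasis A B d"
  shows "card B = CARD('n)"
  using assms eigenbasis_independent[OF assms] dim_span_eq_card_independent[of B]
  by (simp add: eigenbasis_def)

lemma poly_charpoly: "poly (charpoly A) x = det (mat x - A)"
proof -
  have "poly ((mat [:0, 1:] - (\<chi> i j. [:A $ i $ j:])) $ i $ j) x = (mat x - A) $ i $ j" for i j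
    by (simp add: mat_def)
  then show ?thesis
    unfolding charpoly_def det_def by (simp add: poly_sum poly_prod)
qed

text \<open>The matrix \<open>P\<close> with the basis vectors as columns is invertible and
  satisfies \<open>A ** P = P ** D\<close>. Cancelling \<open>det P\<close> compares the two
  polynomials at every real point, which suffices for equality.\<close>

lemma charpoly_eigenbasis:
  fixes A :: "real^'n^'n"
  assumes eb: "eigenbasis A B d"
  shows "charpoly A = (\<Prod>b\<in>B. [:- d b, 1:])"
proof -
  obtain \<beta> :: "'n \<Rightarrow> real^'n" where \<beta>: "bij_betw \<beta> UNIV B"
    using eigenbasis_card[OF eb] eigenbasis_finite[OF eb]
    by (metis finite_same_card_bij finite_class.finite_UNIV)
  define P :: "real^'n^'n" where "P = (\<chi> i j. \<beta> j $ i)"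
  define D :: "real^'n^'n" where "D = (\<chi> i j. if i = j then d (\<beta> j) else 0)"
  have B: "\<beta> j \<in> B" for j using \<beta> by (auto simp: bij_betw_def)
  have "\<beta> i \<bullet> \<beta> j = (if i = j then 1 else 0)" for i j
  proof (cases "i = j")
    case True
    then show ?thesis using eb B by (simp add: eigenbasis_def dot_square_norm)
  next
    case False
    then have "\<beta> i \<noteq> \<beta> j" using \<beta> by (auto simp: bij_betw_def inj_on_def)
    then show ?thesis using False eb B by (auto simp: eigenbasis_def pairwise_def orthogonal_def)
  qed
  then have "transpose P ** P = mat 1"
    by (simp add: P_def matrix_matrix_mult_def transpose_def mat_def inner_vec_def vec_eq_iff)
  then have detP: "det P \<noteq> 0"
    by (metis det_I det_mul mult_zero_right zero_neq_one)
  have "A *v \<beta> j = d (\<beta> j) *\<^sub>R \<beta> j" for j using eb B by (simp add: eigenbasis_def)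
  then have eig: "(\<Sum>k\<in>UNIV. A $ i $ k * \<beta> j $ k) = d (\<beta> j) * \<beta> j $ i" for i j
    by (simp add: matrix_vector_mult_def vec_eq_iff)
  have "poly (charpoly A) x = poly (\<Prod>b\<in>B. [:- d b, 1:]) x" for x
  proof -
    have "(mat x - A) ** P = P ** (mat x - D)"
      by (simp add: matrix_matrix_mult_def P_def D_def mat_def vec_eq_iff eig
          left_diff_distrib right_diff_distrib sum_subtractf if_distrib[of "\<lambda>z. z * _"] if_distrib[of "\<lambda>z. _ * z"] cong: if_cong)
    then have "det (mat x - A) = det (mat x - D)"
      using detP by (metis det_mul mult.commute mult_cancel_left)
    also have "\<dots> = (\<Prod>j\<in>UNIV. x - d (\<beta> j))"
      by (subst det_diagonal) (auto simp: mat_def D_def)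
    also have "\<dots> = (\<Prod>b\<in>B. x - d b)"
      by (rule prod.reindex_bij_betw[OF \<beta>])
    finally show ?thesis
      by (simp add: poly_charpoly poly_prod)
  qed
  then show ?thesis
    by (simp add: poly_eq_poly_eq_iff[symmetric] fun_eq_iff)
qed

text \<open>Both lists of eigenvalues are the root multiset of the same characteristic polynomial.
  Taking a threshold for \<open>P\<close> turns positions in the ordered list into dimensions of
  spans of eigenvectors.\<close>

lemma eigenbasis_count:
  fixes A :: "real^'n^'n"
  assumes eb: "eigenbasis A B d" and ev: "ordered_eigenvalues A lam"
  shows "card {b\<in>B. P (d b)} = card {i\<in>{1..CARD('n)}. P (lam i)}"
proof -
  have roots: "proots (\<Prod>i\<in>I. [:- f i, 1:]) = image_mset f (mset_set I)" if "finite I"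
    for f :: "'b \<Rightarrow> real" and I
    by (subst proots_prod) (auto simp: that sum_unfold_sum_mset)
  have "image_mset d (mset_set B) = image_mset lam (mset_set {1..CARD('n)})"
    using charpoly_eigenbasis[OF eb] ev roots[of B d] roots[of "{1..CARD('n)}" lam] eigenbasis_finite[OF eb]
    by (simp add: ordered_eigenvalues_def)
  then have "size (filter_mset P (image_mset d (mset_set B)))
      = size (filter_mset P (image_mset lam (mset_set {1..CARD('n)})))"
    by simp
  then show ?thesis
    by (simp add: filter_mset_image_mset filter_mset_mset_set eigenbasis_finite[OF eb])
qed

lemma ordered_eigenvalues_antimono:
  fixes A :: "real^'n^'n"
  assumes ev: "ordered_eigenvalues A lam" and "1 \<le> i" "i \<le> j" "j \<le> CARD('n)"
  shows "lam j \<le> lam i"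
  using assms(3,4)
proof (induction rule: dec_induct)
  case (step k)
  then have "lam (Suc k) \<le> lam k"
    using ev \<open>1 \<le> i\<close> by (simp add: ordered_eigenvalues_def)
  with step show ?case by simp
qed simp

lemma eigenbasis_quadratic_form:
  assumes eb: "eigenbasis A B d" and C: "C \<subseteq> B" and x: "x \<in> span C"
  shows "x \<bullet> (A *v x) = (\<Sum>b\<in>C. d b * (x \<bullet> b)\<^sup>2)" and "x \<bullet> x = (\<Sum>b\<in>C. (x \<bullet> b)\<^sup>2)"
proof -
  have fin: "finite C" using C eigenbasis_finite[OF eb] by (rule finite_subset)
  have x_eq: "x = (\<Sum>b\<in>C. (x \<bullet> b) *\<^sub>R b)"
    using orthonormal_basis_expand[of C x] eb C x fin
    by (auto simp: eigenbasis_def pairwise_def subset_iff)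
  have "A *v x = (\<Sum>b\<in>C. A *v ((x \<bullet> b) *\<^sub>R b))"
    by (subst x_eq) (simp add: linear_sum)
  also have "\<dots> = (\<Sum>b\<in>C. (d b * (x \<bullet> b)) *\<^sub>R b)"
    using eb C by (intro sum.cong) (auto simp: eigenbasis_def matrix_vector_mult_scaleR)
  finally have "x \<bullet> (A *v x) = (\<Sum>b\<in>C. (d b * (x \<bullet> b)) * (x \<bullet> b))"
    by (simp add: inner_sum_right)
  then show "x \<bullet> (A *v x) = (\<Sum>b\<in>C. d b * (x \<bullet> b)\<^sup>2)"
    by (simp add: power2_eq_square mult.assoc)
  have "x \<bullet> x = x \<bullet> (\<Sum>b\<in>C. (x \<bullet> b) *\<^sub>R b)" using x_eq by simp
  then show "x \<bullet> x = (\<Sum>b\<in>C. (x \<bullet> b)\<^sup>2)"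
    by (simp add: inner_sum_right power2_eq_square)
qed

text \<open>
  The eigenvectors of \<open>A + E\<close> for eigenvalues \<open>\<ge> lamt i\<close> and those of \<open>A\<close> for eigenvalues
  \<open>\<le> lam i\<close> span subspaces of dimensions adding up to more than \<open>n\<close>; a common nonzero vector
  compares the two quadratic forms.
\<close>
lemma weyl_upper:
  fixes A E :: "real^'n^'n"
  assumes symA: "symmetric_mat A" and symAE: "symmetric_mat (A + E)"
    and lam: "ordered_eigenvalues A lam" and lamt: "ordered_eigenvalues (A + E) lamt"
    and i: "1 \<le> i" "i \<le> CARD('n)"
  shows "lamt i \<le> lam i + spectral_norm E"
proof -
  obtain B d where eb: "eigenbasis A B d"
    using symmetric_mat_eigenbasis[OF symA] .
  obtain B' d' where eb': "eigenbasis (A + E) B' d'"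
    using symmetric_mat_eigenbasis[OF symAE] .
  define U where "U = {b\<in>B. d b \<le> lam i}"
  define V where "V = {b\<in>B'. lamt i \<le> d' b}"
  have "card {i..CARD('n)} \<le> card {j\<in>{1..CARD('n)}. lam j \<le> lam i}"
    using i ordered_eigenvalues_antimono[OF lam] by (intro card_mono) auto
  then have U: "CARD('n) + 1 - i \<le> card U"
    unfolding U_def eigenbasis_count[OF eb lam, of "\<lambda>z. z \<le> lam i"] by simp
  have "card {1..i} \<le> card {j\<in>{1..CARD('n)}. lamt i \<le> lamt j}"
    using i ordered_eigenvalues_antimono[OF lamt] by (intro card_mono) auto
  then have V: "i \<le> card V"
    unfolding V_def eigenbasis_count[OF eb' lamt, of "\<lambda>z. lamt i \<le> z"] by simp
  have "independent U" "independent V"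
    using independent_mono[OF eigenbasis_independent[OF eb], of U]
      independent_mono[OF eigenbasis_independent[OF eb'], of V]
    by (auto simp: U_def V_def)
  then have dims: "dim (span U) = card U" "dim (span V) = card V"
    by (metis dim_span_eq_card_independent)+
  have "dim {x + y |x y. x \<in> span U \<and> y \<in> span V} \<le> CARD('n)"
    using dim_subset_UNIV[of "{x + y |x y. x \<in> span U \<and> y \<in> span V}"] by simp
  with dim_sums_Int[OF subspace_span subspace_span, of U V] have "dim (span U \<inter> span V) > 0"
    using U V i dims by linarith
  then obtain x where x: "x \<in> span U" "x \<in> span V" "x \<noteq> 0"
    by (metis Int_iff dim_eq_0 less_irrefl subsetI singleton_iff)
  have "lamt i * (x \<bullet> x) \<le> x \<bullet> ((A + E) *v x)"
    using eigenbasis_quadratic_form[OF eb' _ x(2)]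
    by (auto simp: V_def sum_distrib_left intro!: sum_mono mult_right_mono)
  also have "\<dots> = x \<bullet> (A *v x) + x \<bullet> (E *v x)"
    by (simp add: matrix_vector_mult_add_rdistrib inner_add_right)
  also have "x \<bullet> (A *v x) \<le> lam i * (x \<bullet> x)"
    using eigenbasis_quadratic_form[OF eb _ x(1)]
    by (auto simp: U_def sum_distrib_left intro!: sum_mono mult_right_mono)
  also have "x \<bullet> (E *v x) \<le> norm x * norm (E *v x)"
    by (rule norm_cauchy_schwarz)
  also have "\<dots> \<le> norm x * (spectral_norm E * norm x)"
    unfolding spectral_norm_def
    using onorm[OF matrix_vector_mul_bounded_linear, of E x] by (intro mult_left_mono) auto
  also have "\<dots> = spectral_norm E * (x \<bullet> x)"
    by (simp add: dot_square_norm power2_eq_square)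
  finally have "lamt i * (x \<bullet> x) \<le> (lam i + spectral_norm E) * (x \<bullet> x)"
    by (simp add: algebra_simps)
  with x(3) show ?thesis by simp
qed

lemma spectral_norm_minus: "spectral_norm (- E) = spectral_norm E"
proof -
  have "(*v) (- E) = (\<lambda>x. - (E *v x))"
    using matrix_vector_mult_diff_rdistrib[of 0 E] by (simp add: fun_eq_iff)
  then show ?thesis
    unfolding spectral_norm_def by (simp add: onorm_neg)
qed

text \<open>The lower estimate is the upper one applied to \<open>A + E\<close> perturbed by
  \<open>- E\<close>.\<close>

lemma weyl:
  fixes A E :: "real^'n^'n"
  assumes "symmetric_mat A" and "symmetric_mat E"
    and "ordered_eigenvalues A lam" and "ordered_eigenvalues (A + E) lamt"
    and "1 \<le> i" "i \<le> CARD('n)"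
  shows "\<bar>lamt i - lam i\<bar> \<le> spectral_norm E"
proof -
  have sym: "symmetric_mat (A + E)"
    using assms(1,2) by (simp add: symmetric_mat_def transpose_def vec_eq_iff)
  have "lamt i \<le> lam i + spectral_norm E"
    using assms sym by (intro weyl_upper)
  moreover have "lam i \<le> lamt i + spectral_norm (- E)"
    using assms sym by (intro weyl_upper[of "A + E" "- E"]) auto
  ultimately show ?thesis
    by (simp add: spectral_norm_minus)
qed

lemma spectral_norm_pos:
  assumes "E \<noteq> 0"
  shows "spectral_norm E > 0"
  using assms unfolding spectral_norm_def
  by (simp add: onorm_pos_lt matrix_eq)

subsection \<open>The three summands of the time bounds\<close>

lemma exp1_ge_2: "exp 1 \<ge> (2::real)"
  using exp_ge_add_one_self[of 1] by simp

text \<open>The left side decreases and the right side increases in \<open>u\<close>, so the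
  endpoint \<open>u - 1 = 2 * exp 1 + 1\<close> decides; there a tangent bound for ln is enough.
  With \<open>u = x / \<alpha>\<^sup>2\<close> this is the sign of the derivative of
  \<open>(H \<alpha> x - ln 2) / x\<close>, and it explains the constant in condition (i).\<close>

lemma ln_div2_ge:
  fixes u :: real
  assumes "u \<ge> 2 * (exp 1 + 1)"
  shows "u / (u - 1) \<le> ln ((u - 1) / 2)"
proof -
  let ?v = "(2 * exp 1 + 1) :: real"
  have v: "?v > 0" by (simp add: add_pos_pos)
  have u: "u - 1 \<ge> ?v" using assms by simp
  have "u / (u - 1) = 1 + 1 / (u - 1)"
    using u v by (simp add: field_simps)
  also have "1 / (u - 1) \<le> 1 / ?v"
    using u v by (intro divide_left_mono) auto
  also have "1 / ?v = 1 - exp 1 / (?v / 2)"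
    using v by (simp add: field_simps)
  also have "\<dots> \<le> ln (?v / 2) - 1"
    using ln_diff_le[of "exp 1" "?v / 2"] v by (simp add: diff_divide_distrib)
  also have "1 + (ln (?v / 2) - 1) \<le> ln ((u - 1) / 2)"
    using u v by simp
  finally show ?thesis by simp
qed

text \<open>Bounding ln by its tangent at \<open>exp 1\<close> leaves a linear function of
  \<open>u\<close>, and \<open>(u - 4 * exp 1)\<^sup>2 \<ge> 0\<close> bounds that by a multiple of
  \<open>u\<^sup>2\<close>.\<close>

lemma ln_div2_le:
  fixes u :: real
  assumes "u > 1"
  shows "ln ((u - 1) / 2) - u / (u - 1) \<le> u\<^sup>2 / (16 * (exp 1)\<^sup>2)"
proof -
  let ?e = "exp 1 :: real"
  have "ln ((u - 1) / 2) \<le> ln (u / 2)" using assms by simp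
  also have "\<dots> \<le> 1 + (u / 2 - ?e) / ?e"
    using ln_diff_le[of "u / 2" ?e] assms by simp
  finally have "ln ((u - 1) / 2) \<le> 1 + (u / 2 - ?e) / ?e" .
  moreover have "1 \<le> u / (u - 1)" using assms by simp
  ultimately have "ln ((u - 1) / 2) - u / (u - 1) \<le> (u / 2 - ?e) / ?e" by linarith
  also have "\<dots> \<le> u\<^sup>2 / (16 * ?e\<^sup>2)"
  proof -
    have "0 \<le> (u - 4 * ?e)\<^sup>2" by simp
    then have "8 * ?e * u - 16 * ?e\<^sup>2 \<le> u\<^sup>2" by (simp add: power2_diff power_mult_distrib mult_ac)
    then have "(8 * ?e * u - 16 * ?e\<^sup>2) / (16 * ?e\<^sup>2) \<le> u\<^sup>2 / (16 * ?e\<^sup>2)"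
      by (intro divide_right_mono) auto
    then show ?thesis by (simp add: diff_divide_distrib power2_eq_square)
  qed
  finally show ?thesis .
qed

text \<open>Mean value theorem: with \<open>u = x / \<alpha>\<^sup>2\<close> the derivative is
  \<open>(u / (u - 1) - ln ((u - 1) / 2)) / x\<^sup>2\<close>. Its sign comes from
  \<open>ln_div2_ge\<close> and its size from \<open>ln_div2_le\<close>, whose
  \<open>u\<^sup>2\<close> cancels the \<open>x\<^sup>2\<close> and leaves a constant.\<close>

lemma H_ratio_mvt:
  assumes "\<alpha> > 0" and m: "2 * (exp 1 + 1) * \<alpha>\<^sup>2 \<le> m" and "m \<le> M"
  shows "(H \<alpha> M - ln 2) / M \<le> (H \<alpha> m - ln 2) / m"
    and "(H \<alpha> m - ln 2) / m - (H \<alpha> M - ln 2) / M \<le> (M - m) / (16 * (exp 1)\<^sup>2 * (\<alpha>\<^sup>2)\<^sup>2)"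
proof -
  let ?\<phi> = "\<lambda>x. (H \<alpha> x - ln 2) / x"
  let ?\<phi>' = "\<lambda>x. (x / \<alpha>\<^sup>2 / (x / \<alpha>\<^sup>2 - 1) - ln ((x / \<alpha>\<^sup>2 - 1) / 2)) / x\<^sup>2"
  have big: "x / \<alpha>\<^sup>2 \<ge> 2 * (exp 1 + 1)" if "m \<le> x" for x
    using that m \<open>\<alpha> > 0\<close> by (simp add: pos_le_divide_eq)
  have gt1: "x / \<alpha>\<^sup>2 > 1" if "m \<le> x" for x
    using big[OF that] exp1_ge_2 by simp
  have pos: "x > 0" if "m \<le> x" for x
    using gt1[OF that] \<open>\<alpha> > 0\<close> by (smt (verit) divide_nonpos_pos zero_less_power)
  have deriv: "(?\<phi> has_real_derivative ?\<phi>' x) (at x)" if "m \<le> x" for x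
    unfolding H_def using gt1[OF that] pos[OF that] \<open>\<alpha> > 0\<close>
    by (auto intro!: derivative_eq_intros simp: ln_div power2_eq_square)
  obtain \<xi> where \<xi>: "m \<le> \<xi>" "?\<phi> M - ?\<phi> m = (M - m) * ?\<phi>' \<xi>"
  proof (cases "m = M")
    case False
    then have "m < M" using \<open>m \<le> M\<close> by simp
    then obtain \<xi> where "m < \<xi>" "?\<phi> M - ?\<phi> m = (M - m) * ?\<phi>' \<xi>"
      using MVT2[OF _ deriv, of m M] by blast
    then show ?thesis by (intro that[of \<xi>]) simp_all
  next
    case True
    then show ?thesis by (intro that[of m]) simp_all
  qed
  have "?\<phi>' \<xi> \<le> 0"
    using ln_div2_ge[OF big[OF \<xi>(1)]] by (intro divide_nonpos_nonneg) auto
  with \<xi>(2) \<open>m \<le> M\<close> show "?\<phi> M \<le> ?\<phi> m"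
    using mult_nonneg_nonpos[of "M - m" "?\<phi>' \<xi>"] by simp
  have "- ?\<phi>' \<xi> = (ln ((\<xi> / \<alpha>\<^sup>2 - 1) / 2) - \<xi> / \<alpha>\<^sup>2 / (\<xi> / \<alpha>\<^sup>2 - 1)) / \<xi>\<^sup>2"
    by (simp only: minus_divide_left minus_diff_eq)
  also have "\<dots> \<le> ((\<xi> / \<alpha>\<^sup>2)\<^sup>2 / (16 * (exp 1)\<^sup>2)) / \<xi>\<^sup>2"
    using ln_div2_le[OF gt1[OF \<xi>(1)]] by (intro divide_right_mono) auto
  also have "\<dots> = 1 / (16 * (exp 1)\<^sup>2 * (\<alpha>\<^sup>2)\<^sup>2)"
    using pos[OF \<xi>(1)] \<open>\<alpha> > 0\<close> by (simp add: power_divide)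
  finally have "(M - m) * (- ?\<phi>' \<xi>) \<le> (M - m) * (1 / (16 * (exp 1)\<^sup>2 * (\<alpha>\<^sup>2)\<^sup>2))"
    using \<open>m \<le> M\<close> by (intro mult_left_mono) auto
  with \<xi>(2) show "?\<phi> m - ?\<phi> M \<le> (M - m) / (16 * (exp 1)\<^sup>2 * (\<alpha>\<^sup>2)\<^sup>2)"
    by simp
qed

section \<open>Perturbation of the logarithmic summand\<close>

lemma ln_diff_less:
  fixes x y :: real
  assumes "0 < x" "0 < y" "x \<noteq> y"
  shows "ln x - ln y < (x - y) / y"
proof -
  have "ln (x / y) \<le> x / y - 1" "ln (x / y) \<noteq> x / y - 1"
    using assms ln_le_minus_one[of "x / y"] ln_eq_minus_one[of "x / y"] by auto
  with assms show ?thesis by (simp add: ln_div diff_divide_distrib)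
qed

text \<open>The smaller of \<open>x\<close> and \<open>y\<close> is at least \<open>x - e\<close>.
  Strictness comes from \<open>ln_diff_less\<close> if \<open>y \<noteq> x\<close> and from
  \<open>e > 0\<close> otherwise.\<close>

lemma abs_ln_diff_less:
  fixes x y e :: real
  assumes "0 < e" "e < x" "\<bar>y - x\<bar> \<le> e"
  shows "\<bar>ln y - ln x\<bar> < e / (x - e)"
proof -
  have bound: "d / z \<le> e / (x - e)" if "d \<le> e" "x - e \<le> z" for d z
    using assms that by (intro frac_le) auto
  consider "y = x" | "x < y" | "y < x" by linarith
  then show ?thesis
  proof cases
    case 2
    then show ?thesis
      using ln_diff_less[of y x] bound[of "y - x" x] assms by auto
  next
    case 3
    then show ?thesis
      using ln_diff_less[of x y] bound[of "x - y" y] assms by auto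
  qed (use assms in auto)
qed

text \<open>The change of the numerator and that of the denominator are estimated separately; the
  strict inequality comes from the numerator.\<close>

lemma H_ratio_diff_less:
  assumes "\<alpha> > 0" "e > 0" and ab: "\<bar>b - a\<bar> \<le> e" and a: "a - e > \<alpha>\<^sup>2"
  shows "\<bar>(H \<alpha> b - C) / b - (H \<alpha> a - C) / a\<bar>
    < e / (a - e) * (1 / (a - e - \<alpha>\<^sup>2) + \<bar>H \<alpha> a - C\<bar> / a)"
proof -
  have p: "\<alpha>\<^sup>2 > 0" using \<open>\<alpha> > 0\<close> by simp
  have pos: "0 < a" "0 < b" "0 < a - e" "a - e \<le> b" using assms p by linarith+
  have H_eq: "H \<alpha> x = ln (x - \<alpha>\<^sup>2) - ln (\<alpha>\<^sup>2)" if "x > \<alpha>\<^sup>2" for x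
  proof -
    have "x / \<alpha>\<^sup>2 - 1 = (x - \<alpha>\<^sup>2) / \<alpha>\<^sup>2" using p by (simp add: diff_divide_distrib)
    then show ?thesis unfolding H_def using that p by (simp add: ln_div)
  qed
  have "H \<alpha> b - H \<alpha> a = ln (b - \<alpha>\<^sup>2) - ln (a - \<alpha>\<^sup>2)"
    using H_eq[of a] H_eq[of b] assms by simp
  moreover have "\<bar>ln (b - \<alpha>\<^sup>2) - ln (a - \<alpha>\<^sup>2)\<bar> < e / (a - \<alpha>\<^sup>2 - e)"
    using assms by (intro abs_ln_diff_less) auto
  ultimately have Hd: "\<bar>H \<alpha> b - H \<alpha> a\<bar> < e / (a - e - \<alpha>\<^sup>2)"
    by (simp add: algebra_simps)
  have "(H \<alpha> b - C) / b - (H \<alpha> a - C) / a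
      = (H \<alpha> b - H \<alpha> a) / b + (H \<alpha> a - C) * ((a - b) / (a * b))"
    using pos by (simp add: field_simps)
  then have "\<bar>(H \<alpha> b - C) / b - (H \<alpha> a - C) / a\<bar>
      \<le> \<bar>H \<alpha> b - H \<alpha> a\<bar> / b + \<bar>H \<alpha> a - C\<bar> * (\<bar>a - b\<bar> / (a * b))"
    using pos abs_triangle_ineq[of "(H \<alpha> b - H \<alpha> a) / b" "(H \<alpha> a - C) * ((a - b) / (a * b))"]
    by (simp add: abs_mult)
  also have "\<bar>H \<alpha> b - H \<alpha> a\<bar> / b \<le> \<bar>H \<alpha> b - H \<alpha> a\<bar> / (a - e)"
    using pos by (intro divide_left_mono) auto
  also have "\<dots> < (e / (a - e - \<alpha>\<^sup>2)) / (a - e)"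
    using Hd pos by (intro divide_strict_right_mono) auto
  also have "\<bar>H \<alpha> a - C\<bar> * (\<bar>a - b\<bar> / (a * b)) \<le> \<bar>H \<alpha> a - C\<bar> * (e / (a * (a - e)))"
    using pos ab by (intro mult_left_mono frac_le) auto
  finally show ?thesis
    by (simp add: algebra_simps)
qed

text \<open>
  If \<open>l\<close> lies in the range where \<open>x \<mapsto> (H x - ln 2) / x\<close> decreases, the bound at \<open>a\<close> carries over
  to \<open>l\<close>. Otherwise \<open>l < 2(e + 1)\<alpha>\<^sup>2\<close>, and the derivative of this function on \<open>[2(e + 1)\<alpha>\<^sup>2, \<infinity>)\<close> is
  so small that the first summand alone suffices.
\<close>
lemma H_ratio_diff_le_below:
  assumes "\<alpha> > 0" "e > 0" and ab: "\<bar>b - a\<bar> \<le> e"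
    and a: "2 * (exp 1 + 1) * \<alpha>\<^sup>2 \<le> a" and b: "2 * (exp 1 + 1) * \<alpha>\<^sup>2 \<le> b"
    and l: "l \<le> a" "l - e > \<alpha>\<^sup>2"
  shows "\<bar>(H \<alpha> b - ln 2) / b - (H \<alpha> a - ln 2) / a\<bar>
    \<le> e / (l - e) * (1 / (l - e - \<alpha>\<^sup>2) + \<bar>H \<alpha> l - ln 2\<bar> / l)"
proof -
  have p: "\<alpha>\<^sup>2 > 0" using \<open>\<alpha> > 0\<close> by simp
  then have l0: "l - e > 0" "l > 0" "a > 0" using l \<open>e > 0\<close> by linarith+
  show ?thesis
  proof (cases "2 * (exp 1 + 1) * \<alpha>\<^sup>2 \<le> l")
    case True
    have "2 * (exp 1 + 1) \<le> a / \<alpha>\<^sup>2"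
      using a p by (simp add: pos_le_divide_eq)
    moreover have "6 \<le> 2 * (exp 1 + 1 :: real)" using exp1_ge_2 by simp
    ultimately have "2 \<le> a / \<alpha>\<^sup>2 - 1" by (smt (verit))
    then have "H \<alpha> a \<ge> ln 2" by (simp add: H_def)
    then have "\<bar>H \<alpha> a - ln 2\<bar> / a = (H \<alpha> a - ln 2) / a" by simp
    also have "\<dots> \<le> (H \<alpha> l - ln 2) / l"
      using H_ratio_mvt(1)[OF \<open>\<alpha> > 0\<close> True l(1)] .
    also have "\<dots> \<le> \<bar>H \<alpha> l - ln 2\<bar> / l"
      using l0 by (intro divide_right_mono) auto
    finally have "e / (a - e) * (1 / (a - e - \<alpha>\<^sup>2) + \<bar>H \<alpha> a - ln 2\<bar> / a)
        \<le> e / (l - e) * (1 / (l - e - \<alpha>\<^sup>2) + \<bar>H \<alpha> l - ln 2\<bar> / l)"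
      using l l0 \<open>e > 0\<close> by (intro mult_mono add_mono divide_left_mono) auto
    with H_ratio_diff_less[of \<alpha> e b a "ln 2"] assms show ?thesis by simp
  next
    case False
    have "\<bar>(H \<alpha> b - ln 2) / b - (H \<alpha> a - ln 2) / a\<bar> \<le> \<bar>b - a\<bar> / (16 * (exp 1)\<^sup>2 * (\<alpha>\<^sup>2)\<^sup>2)"
    proof (cases "a \<le> b")
      case True
      then show ?thesis using H_ratio_mvt[OF \<open>\<alpha> > 0\<close> a True] by simp
    next
      case False
      then show ?thesis using H_ratio_mvt[OF \<open>\<alpha> > 0\<close> b, of a] by simp
    qed
    \<comment> \<open>Here \<open>l < 2 * (exp 1 + 1) * \<alpha>\<^sup>2\<close>, so the new
      denominator is at most \<open>(4 * (exp 1)\<^sup>2 + 6 * exp 1 + 2) *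
      (\<alpha>\<^sup>2)\<^sup>2\<close>, below the old one.\<close>
    also have "\<dots> \<le> e / ((l - e) * (l - e - \<alpha>\<^sup>2))"
    proof (intro frac_le)
      have "(l - e) * (l - e - \<alpha>\<^sup>2) \<le> (2 * (exp 1 + 1) * \<alpha>\<^sup>2) * (2 * (exp 1 + 1) * \<alpha>\<^sup>2 - \<alpha>\<^sup>2)"
        using False l l0 \<open>e > 0\<close> by (intro mult_mono) auto
      also have "\<dots> = (4 * (exp 1)\<^sup>2 + 6 * exp 1 + 2) * (\<alpha>\<^sup>2)\<^sup>2"
        by (simp add: algebra_simps power2_eq_square)
      also have "\<dots> \<le> (16 * (exp 1)\<^sup>2) * (\<alpha>\<^sup>2)\<^sup>2"
      proof (intro mult_right_mono)
        have "2 * exp 1 \<le> (exp 1 :: real)\<^sup>2" "(2::real) \<le> exp 1"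
          using exp1_ge_2 by (simp_all add: power2_eq_square)
        then show "4 * (exp 1)\<^sup>2 + 6 * exp 1 + 2 \<le> 16 * (exp 1 :: real)\<^sup>2" by linarith
      qed simp
      finally show "(l - e) * (l - e - \<alpha>\<^sup>2) \<le> 16 * (exp 1)\<^sup>2 * (\<alpha>\<^sup>2)\<^sup>2" .
    qed (use ab l l0 \<open>e > 0\<close> in auto)
    also have "\<dots> = e / (l - e) * (1 / (l - e - \<alpha>\<^sup>2))" by simp
    also have "\<dots> \<le> e / (l - e) * (1 / (l - e - \<alpha>\<^sup>2) + \<bar>H \<alpha> l - ln 2\<bar> / l)"
      using l0 \<open>e > 0\<close> by (intro mult_left_mono) auto
    finally show ?thesis .
  qed
qed

text \<open>Tangent bounds for ln at both ends control the difference of the logarithms. The lower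
  bound has the shape of condition (ii) and yields monotonicity; the upper bound serves the
  perturbation estimate.\<close>

lemma inverse_abs_ln_diff:
  fixes c x y :: real
  assumes "0 < c" "0 < y" "y \<le> x" "c * x < 1"
  shows "c * (x - y) / ((1 - c * y) * (ln (1 - c * x))\<^sup>2) \<le> 1 / \<bar>ln (1 - c * y)\<bar> - 1 / \<bar>ln (1 - c * x)\<bar>"
    and "1 / \<bar>ln (1 - c * y)\<bar> - 1 / \<bar>ln (1 - c * x)\<bar> \<le> (x - y) / (c * x * y * (1 - c * x))"
proof -
  define p where "p = - ln (1 - c * x)"
  define q where "q = - ln (1 - c * y)"
  have cxy: "0 < c * y" "c * y \<le> c * x" using assms by auto
  have p: "c * x \<le> p" and q: "c * y \<le> q"
    using ln_le_minus_one[of "1 - c * x"] ln_le_minus_one[of "1 - c * y"] assms cxy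
    by (auto simp: p_def q_def)
  have pq: "0 < q" "q \<le> p" "0 < p"
    using q cxy assms ln_mono[of "1 - c * x" "1 - c * y"] unfolding p_def q_def by linarith+
  have diff: "1 / q - 1 / p = (p - q) / (p * q)"
    using pq by (simp add: field_simps)
  have abs: "\<bar>ln (1 - c * x)\<bar> = p" "\<bar>ln (1 - c * y)\<bar> = q" "(ln (1 - c * x))\<^sup>2 = p\<^sup>2"
    using pq by (auto simp: p_def q_def)
  have lower: "c * (x - y) / (1 - c * y) \<le> p - q"
    using ln_diff_le[of "1 - c * x" "1 - c * y"] assms cxy
      minus_divide_left[of "c * (x - y)" "1 - c * y"]
    by (simp add: p_def q_def algebra_simps)
  have upper: "p - q \<le> c * (x - y) / (1 - c * x)"
    using ln_diff_le[of "1 - c * y" "1 - c * x"] assms cxy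
    by (simp add: p_def q_def algebra_simps)
  have "c * (x - y) / ((1 - c * y) * p\<^sup>2) \<le> (p - q) / p\<^sup>2"
    using divide_right_mono[OF lower, of "p\<^sup>2"] by simp
  also have "\<dots> \<le> (p - q) / (p * q)"
    using pq by (intro divide_left_mono) (auto simp: power2_eq_square)
  finally show "c * (x - y) / ((1 - c * y) * (ln (1 - c * x))\<^sup>2) \<le> 1 / \<bar>ln (1 - c * y)\<bar> - 1 / \<bar>ln (1 - c * x)\<bar>"
    by (simp add: abs diff)
  \<comment> \<open>The logarithms in the denominator are replaced using
    \<open>c * x \<le> p\<close> and \<open>c * y \<le> q\<close>.\<close>
  have "(p - q) / (p * q) \<le> (c * (x - y) / (1 - c * x)) / (c * x * (c * y))"
    using upper pq p q cxy assms less_imp_le[OF pq(3)]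
    by (intro frac_le mult_mono) auto
  also have "\<dots> = (x - y) / (c * x * y * (1 - c * x))"
    using assms by (simp add: field_simps)
  finally show "1 / \<bar>ln (1 - c * y)\<bar> - 1 / \<bar>ln (1 - c * x)\<bar> \<le> (x - y) / (c * x * y * (1 - c * x))"
    by (simp add: abs diff)
qed

text \<open>Replacing \<open>a\<close> by the smaller \<open>l\<close> costs nothing because \<open>x (1 - c x)\<close> increases for \<open>c x \<le> 1/2\<close>.\<close>
lemma inverse_abs_ln_diff_le_below:
  fixes a b c e l :: real
  assumes "0 < c" "0 < e" and ab: "\<bar>b - a\<bar> \<le> e" and l: "l \<le> a" "0 < l - e"
    and ca: "c * a \<le> 1 / 2" and cb: "c * b \<le> 1 / 2" and cl: "c * (l + e) < 1"
  shows "\<bar>1 / \<bar>ln (1 - c * b)\<bar> - 1 / \<bar>ln (1 - c * a)\<bar>\<bar> \<le> e / (c * l * (l - e) * (1 - c * (l + e)))"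
proof -
  \<comment> \<open>The ordered version, used with the larger of \<open>a\<close> and
    \<open>b\<close> as \<open>x\<close>.\<close>
  have main: "\<bar>1 / \<bar>ln (1 - c * y)\<bar> - 1 / \<bar>ln (1 - c * x)\<bar>\<bar> \<le> e / (c * l * (l - e) * (1 - c * (l + e)))"
    if xy: "y \<le> x" "x - y \<le> e" "l - e \<le> y" "l \<le> x" "c * x \<le> 1 / 2" for x y
  proof -
    have pos: "0 < y" "0 < l" "0 < x" using xy l \<open>0 < e\<close> by linarith+
    have cx: "c * x < 1" using xy by simp
    have "c * l \<le> c * x" using xy \<open>0 < c\<close> by simp
    then have "0 \<le> 1 - c * x - c * l" using xy(5) by linarith
    \<comment> \<open>This product equals \<open>x * (1 - c * x) - l * (1 - c * l)\<close>.\<close>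
    then have "0 \<le> (x - l) * (1 - c * x - c * l)"
      using xy by (intro mult_nonneg_nonneg) auto
    then have "l * (1 - c * l) \<le> x * (1 - c * x)"
      by (simp add: algebra_simps)
    moreover have "l * (1 - c * (l + e)) \<le> l * (1 - c * l)"
      using pos \<open>0 < c\<close> \<open>0 < e\<close> by (intro mult_left_mono) auto
    ultimately have "l * (1 - c * (l + e)) \<le> x * (1 - c * x)" by linarith
    then have "c * (l - e) * (l * (1 - c * (l + e))) \<le> c * y * (x * (1 - c * x))"
      using xy l cl pos \<open>0 < c\<close> by (intro mult_mono[of "c * (l - e)"]) auto
    then have *: "(x - y) / (c * x * y * (1 - c * x)) \<le> e / (c * l * (l - e) * (1 - c * (l + e)))"
      using xy l cl pos \<open>0 < c\<close> by (intro frac_le) (auto simp: mult_ac)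
    have "c * y \<le> c * x" using xy \<open>0 < c\<close> by simp
    then have "0 \<le> 1 - c * y" using cx by linarith
    then have "0 \<le> c * (x - y) / ((1 - c * y) * (ln (1 - c * x))\<^sup>2)"
      using xy \<open>0 < c\<close> by (intro divide_nonneg_nonneg mult_nonneg_nonneg) auto
    with * show ?thesis
      using inverse_abs_ln_diff[OF \<open>0 < c\<close> pos(1) xy(1) cx] by linarith
  qed
  show ?thesis
  proof (cases "b \<le> a")
    case True
    then show ?thesis using main[of b a] assms by auto
  next
    case False
    then show ?thesis using main[of a b] assms by (auto simp: abs_minus_commute)
  qed
qed

section \<open>Monotonicity of \<open>T2_Id\<close> along the sequence\<close>

lemma K_pos:
  assumes "0 < \<epsilon>" "\<epsilon> < 1"
  shows "K \<epsilon> > 0"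
proof -
  \<comment> \<open>The constant 7/8 is chosen so that
    \<open>1 / (1 - sqrt (1 / 3)) < 8\<close>.\<close>
  have s: "sqrt (1 / 3) < 7 / 8"
    by (rule real_less_lsqrt) (auto simp: power2_eq_square)
  then have "\<bar>ln (1 - sqrt (1 / 3))\<bar> = ln (1 / (1 - sqrt (1 / 3)))"
    by (simp add: ln_div ln_le_zero_iff abs_of_nonpos)
  also have "\<dots> < ln 8"
    using s by (subst ln_less_cancel_iff) (auto simp: field_simps)
  also have "\<dots> < ln (8 / \<epsilon>)"
    using assms by (subst ln_less_cancel_iff) (auto simp: field_simps)
  finally show ?thesis by (simp add: K_def)
qed

text \<open>For this choice of \<open>\<rho>\<close> the quotient \<open>sqrt x / \<rho>\<close> is
  \<open>8 / \<epsilon>\<close>, so the numerator of the last summand is the constant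
  \<open>K \<epsilon>\<close>.\<close>

lemma T2_Id_eps:
  assumes "x > 0" "\<epsilon> > 0"
  shows "T2_Id x (sqrt x / 8 * \<epsilon>) \<alpha> \<eta> =
    (H \<alpha> x - ln 2) / x / (2 * \<eta>) + ceil_steps \<alpha> x + K \<epsilon> * (1 / \<bar>ln (1 - 2 / 3 * \<eta> * x)\<bar>)"
proof -
  have "sqrt x / (sqrt x / 8 * \<epsilon>) = 8 / \<epsilon>" using assms by simp
  then show ?thesis by (simp add: T2_Id_def K_def mult_ac)
qed

text \<open>Since \<open>x \<ge> 1\<close>, the logarithm's argument \<open>2 / sqrt x\<close> is at
  most 2, hence below \<open>8 / \<epsilon>\<close>. Thus the separate first entry of the maximum in
  \<open>T0_fun\<close> never exceeds the entry for index 1.\<close>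

lemma T2_Id_half_le:
  assumes "x \<ge> 1" "0 < \<epsilon>" "\<epsilon> < 1"
  shows "T2_Id x (x / 2) \<alpha> \<eta> \<le> T2_Id x (sqrt x / 8 * \<epsilon>) \<alpha> \<eta>"
proof -
  have "sqrt x / (x / 2) = 2 / sqrt x"
    using assms by (simp add: field_simps)
  also have "\<dots> \<le> 2" using assms by (simp add: divide_le_eq)
  also have "\<dots> \<le> sqrt x / (sqrt x / 8 * \<epsilon>)"
    using assms by (simp add: field_simps)
  finally have "ln (sqrt x / (x / 2)) \<le> ln (sqrt x / (sqrt x / 8 * \<epsilon>))"
    using assms by (subst ln_le_cancel_iff) auto
  then show ?thesis
    unfolding T2_Id_def by (intro add_left_mono divide_right_mono diff_right_mono) auto
qed

text \<open>Condition (ii) says exactly that the last summand of \<open>T2_Id\<close> outweighs the jump of the ceilings.\<close>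
lemma T2_Id_antimono_step:
  assumes "\<alpha> > 0" "\<eta> > 0" "0 < \<epsilon>" "\<epsilon> < 1"
    and y: "2 * (exp 1 + 1) * \<alpha>\<^sup>2 \<le> y" and "y \<le> x" and x: "\<eta> * x < 1 / 4"
    and gap: "x - y \<ge> 3 * (1 - 2 / 3 * \<eta> * y) * (ln (1 - 2 / 3 * \<eta> * x))\<^sup>2 / (2 * \<eta> * K \<epsilon>)
      * (ceil_steps \<alpha> x - ceil_steps \<alpha> y)"
  shows "T2_Id x (sqrt x / 8 * \<epsilon>) \<alpha> \<eta> \<le> T2_Id y (sqrt y / 8 * \<epsilon>) \<alpha> \<eta>"
proof -
  let ?c = "2 / 3 * \<eta>"
  let ?D = "(1 - ?c * y) * (ln (1 - ?c * x))\<^sup>2"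
  have "0 < 2 * (exp 1 + 1) * \<alpha>\<^sup>2"
    using \<open>\<alpha> > 0\<close> by (simp add: add_pos_pos)
  then have pos: "0 < y" "0 < x" using y \<open>y \<le> x\<close> by linarith+
  have c: "0 < ?c" "?c * x < 1" "?c * y \<le> ?c * x" "0 < ?c * x"
    using assms pos by auto
  have K: "K \<epsilon> > 0" using assms by (intro K_pos)
  have "ln (1 - ?c * x) < 0" using c by simp
  moreover have "1 - ?c * y > 0" using c by linarith
  ultimately have D: "?D > 0" by (intro mult_pos_pos zero_less_power2[THEN iffD2]) auto
  \<comment> \<open>Condition (ii) rewritten with \<open>?c\<close>, as 3 / (2 \<eta>) is
    \<open>1 / ?c\<close>.\<close>
  have "?D * (ceil_steps \<alpha> x - ceil_steps \<alpha> y) / (?c * K \<epsilon>) \<le> x - y"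
    using gap by (simp add: field_simps)
  then have "(ceil_steps \<alpha> x - ceil_steps \<alpha> y) * ?D \<le> (x - y) * (?c * K \<epsilon>)"
    using c(1) K by (subst (asm) pos_divide_le_eq) (simp_all add: mult_ac)
  then have "ceil_steps \<alpha> x - ceil_steps \<alpha> y \<le> (x - y) * (?c * K \<epsilon>) / ?D"
    using D by (subst pos_le_divide_eq)
  also have "\<dots> = K \<epsilon> * (?c * (x - y) / ?D)"
    by (simp only: mult_ac times_divide_eq_right)
  also have "\<dots> \<le> K \<epsilon> * (1 / \<bar>ln (1 - ?c * y)\<bar> - 1 / \<bar>ln (1 - ?c * x)\<bar>)"
    using inverse_abs_ln_diff(1)[OF c(1) pos(1) \<open>y \<le> x\<close> c(2)] K by (intro mult_left_mono) auto
  finally have "ceil_steps \<alpha> x + K \<epsilon> * (1 / \<bar>ln (1 - ?c * x)\<bar>) \<le> ceil_steps \<alpha> y + K \<epsilon> * (1 / \<bar>ln (1 - ?c * y)\<bar>)"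
    by (simp add: right_diff_distrib)
  moreover have "(H \<alpha> x - ln 2) / x / (2 * \<eta>) \<le> (H \<alpha> y - ln 2) / y / (2 * \<eta>)"
    using H_ratio_mvt(1)[OF \<open>\<alpha> > 0\<close> y \<open>y \<le> x\<close>] \<open>\<eta> > 0\<close> by (intro divide_right_mono) auto
  ultimately show ?thesis
    using T2_Id_eps[OF pos(1) \<open>0 < \<epsilon>\<close>] T2_Id_eps[OF pos(2) \<open>0 < \<epsilon>\<close>] by simp
qed

lemma T0_fun_eq:
  assumes "\<alpha> > 0" "\<eta> > 0" "0 < \<epsilon>" "\<epsilon> < 1" "1 \<le> L"
    and mono: "\<And>i j. 1 \<le> i \<Longrightarrow> i \<le> j \<Longrightarrow> j \<le> L \<Longrightarrow> \<nu> j \<le> \<nu> i"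
    and \<nu>1: "\<eta> * \<nu> 1 < 1 / 4"
    and S: "spectral_conditions \<alpha> \<eta> \<epsilon> \<epsilon>' L \<nu>"
  shows "T0_fun \<alpha> \<eta> \<epsilon> L \<nu> = T2_Id (\<nu> L) (sqrt (\<nu> L) / 8 * \<epsilon>) \<alpha> \<eta>"
proof -
  define g where "g l = T2_Id (\<nu> l) (sqrt (\<nu> l) / 8 * \<epsilon>) \<alpha> \<eta>" for l
  have step: "g l \<le> g (Suc l)" if l: "1 \<le> l" "l < L" for l
    unfolding g_def
  proof (rule T2_Id_antimono_step)
    show "2 * (exp 1 + 1) * \<alpha>\<^sup>2 \<le> \<nu> (Suc l)"
      using S mono[of "Suc l" L] l by (auto simp: spectral_conditions_def)
    show "\<eta> * \<nu> l < 1 / 4"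
    proof -
      have "\<eta> * \<nu> l \<le> \<eta> * \<nu> 1" using mono[of 1 l] l \<open>\<eta> > 0\<close> by simp
      with \<nu>1 show ?thesis by linarith
    qed
    show "3 * (1 - 2 / 3 * \<eta> * \<nu> (Suc l)) * (ln (1 - 2 / 3 * \<eta> * \<nu> l))\<^sup>2 / (2 * \<eta> * K \<epsilon>) *
      (ceil_steps \<alpha> (\<nu> l) - ceil_steps \<alpha> (\<nu> (Suc l))) \<le> \<nu> l - \<nu> (Suc l)"
      using S l by (auto simp: spectral_conditions_def)
  qed (use assms l in auto)
  have le: "g l \<le> g L" if "1 \<le> l" "l \<le> L" for l
    using that(2)
  proof (induction rule: inc_induct)
    case (step m)
    with \<open>1 \<le> l\<close> show ?case using \<open>\<And>l. 1 \<le> l \<Longrightarrow> l < L \<Longrightarrow> g l \<le> g (Suc l)\<close>[of m] by simp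
  qed simp
  have "(MAX l\<in>{1..L}. g l) = g L"
    using le \<open>1 \<le> L\<close> by (intro Max_eqI) auto
  moreover have "T2_Id (\<nu> 1) (\<nu> 1 / 2) \<alpha> \<eta> \<le> g L"
    using T2_Id_half_le[of "\<nu> 1" \<epsilon> \<alpha> \<eta>] S assms le[of 1]
    by (auto simp: g_def spectral_conditions_def)
  ultimately show ?thesis
    by (simp add: T0_fun_def g_def)
qed

text \<open>Rounding changes a difference by less than 1, whence the final \<open>+ 1\<close> and
  the strict inequality. The difference of square roots is rationalised, and its denominator is
  bounded below through \<open>l \<le> a\<close> and \<open>l - e \<le> b\<close>.\<close>

lemma ceil_steps_diff_less:
  assumes "\<alpha> > 0" and ab: "\<bar>b - a\<bar> \<le> e" and l: "l \<le> a" "0 < l - e"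
  shows "\<bar>ceil_steps \<alpha> b - ceil_steps \<alpha> a\<bar> < e / (sqrt 3 * \<alpha>) * (1 / (sqrt (l - e) + sqrt l)) + 1"
proof -
  have pos: "0 < a" "0 < b" "0 < l" "l - e \<le> b" "0 \<le> e" using ab l by linarith+
  have "\<bar>ceil_steps \<alpha> b - ceil_steps \<alpha> a\<bar> < \<bar>sqrt (b / 3) * (1 / \<alpha>) - sqrt (a / 3) * (1 / \<alpha>)\<bar> + 1"
    unfolding ceil_steps_def by linarith
  also have "sqrt (b / 3) * (1 / \<alpha>) - sqrt (a / 3) * (1 / \<alpha>) = (sqrt b - sqrt a) / (sqrt 3 * \<alpha>)"
    by (simp add: real_sqrt_divide diff_divide_distrib)
  also have "sqrt b - sqrt a = (b - a) / (sqrt b + sqrt a)"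
  proof -
    have "(sqrt b - sqrt a) * (sqrt b + sqrt a) = b - a"
      using pos by (simp add: algebra_simps)
    moreover have "sqrt b + sqrt a > 0" using pos by (simp add: add_pos_pos)
    ultimately show ?thesis by (simp add: eq_divide_eq)
  qed
  also have "\<bar>(b - a) / (sqrt b + sqrt a) / (sqrt 3 * \<alpha>)\<bar> = \<bar>b - a\<bar> / (sqrt b + sqrt a) / (sqrt 3 * \<alpha>)"
    using pos \<open>\<alpha> > 0\<close> by simp
  also have "\<dots> \<le> e / (sqrt (l - e) + sqrt l) / (sqrt 3 * \<alpha>)"
    using pos l ab \<open>\<alpha> > 0\<close> by (intro divide_right_mono frac_le add_mono) (auto simp: add_pos_pos)
  finally show ?thesis by (simp add: mult_ac)
qed

lemma T2_Id_diff_less: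
  assumes "\<alpha> > 0" "\<eta> > 0" "0 < \<epsilon>" "\<epsilon> < 1" "0 < e" and ab: "\<bar>b - a\<bar> \<le> e"
    and a: "2 * (exp 1 + 1) * \<alpha>\<^sup>2 \<le> a" and b: "2 * (exp 1 + 1) * \<alpha>\<^sup>2 \<le> b"
    and l: "l \<le> a" "l - e > \<alpha>\<^sup>2"
    and \<eta>: "\<eta> * a < 1 / 4" "\<eta> * b < 1 / 4" "2 / 3 * \<eta> * (l + e) < 1"
  shows "\<bar>T2_Id b (sqrt b / 8 * \<epsilon>) \<alpha> \<eta> - T2_Id a (sqrt a / 8 * \<epsilon>) \<alpha> \<eta>\<bar> <
    e / (2 * \<eta> * (l - e)) * (1 / (l - e - \<alpha>\<^sup>2) + \<bar>H \<alpha> l - ln 2\<bar> / l)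
    + e / (sqrt 3 * \<alpha>) * (1 / (sqrt (l - e) + sqrt l))
    + 9 * K \<epsilon> * e / (2 * \<eta> * l * (l - e) * \<bar>3 - 2 * \<eta> * (l + e)\<bar>) + 1"
proof -
  let ?\<phi> = "\<lambda>x. (H \<alpha> x - ln 2) / x"
  let ?r = "\<lambda>x. 1 / \<bar>ln (1 - 2 / 3 * \<eta> * x)\<bar>"
  let ?c = "2 / 3 * \<eta>"
  have "\<alpha>\<^sup>2 > 0" using \<open>\<alpha> > 0\<close> by simp
  then have pos: "0 < l - e" "0 < l" "0 < a" "0 < b" using ab l \<open>0 < e\<close> by linarith+
  have K: "K \<epsilon> > 0" using assms by (intro K_pos)
  have "\<bar>?\<phi> b - ?\<phi> a\<bar> / (2 * \<eta>) \<le> e / (l - e) * (1 / (l - e - \<alpha>\<^sup>2) + \<bar>H \<alpha> l - ln 2\<bar> / l) / (2 * \<eta>)"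
    using H_ratio_diff_le_below[of \<alpha> e b a l] assms by (intro divide_right_mono) auto
  also have "\<dots> = e / (2 * \<eta> * (l - e)) * (1 / (l - e - \<alpha>\<^sup>2) + \<bar>H \<alpha> l - ln 2\<bar> / l)"
    by simp
  finally have 1: "\<bar>?\<phi> b / (2 * \<eta>) - ?\<phi> a / (2 * \<eta>)\<bar> \<le> e / (2 * \<eta> * (l - e)) * (1 / (l - e - \<alpha>\<^sup>2) + \<bar>H \<alpha> l - ln 2\<bar> / l)"
    using \<open>\<eta> > 0\<close> by (simp only: diff_divide_distrib[symmetric] abs_divide abs_of_pos zero_less_mult_iff)
  have 2: "\<bar>ceil_steps \<alpha> b - ceil_steps \<alpha> a\<bar> < e / (sqrt 3 * \<alpha>) * (1 / (sqrt (l - e) + sqrt l)) + 1"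
    using assms pos by (intro ceil_steps_diff_less) auto
  have "K \<epsilon> * \<bar>?r b - ?r a\<bar> \<le> K \<epsilon> * (e / (?c * l * (l - e) * (1 - ?c * (l + e))))"
    using assms pos K inverse_abs_ln_diff_le_below[of ?c e b a l] by (intro mult_left_mono) auto
  \<comment> \<open>Clearing \<open>?c\<close> contributes one factor 3, and writing
    \<open>3 - 2 * \<eta> * (l + e)\<close> as three times \<open>1 - ?c * (l + e)\<close> the
    other.\<close>
  also have "\<dots> = 9 * K \<epsilon> * e / (2 * \<eta> * l * (l - e) * \<bar>3 - 2 * \<eta> * (l + e)\<bar>)"
  proof -
    have "\<bar>3 - 2 * \<eta> * (l + e)\<bar> = 3 * (1 - ?c * (l + e))" using \<eta>(3) by simp
    moreover have "K \<epsilon> * (e / (?c * l * d * w)) = 9 * K \<epsilon> * e / (2 * \<eta> * l * d * (3 * w))" for d w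
      by (simp add: mult_ac)
    ultimately show ?thesis by (simp only:)
  qed
  finally have 3: "\<bar>K \<epsilon> * ?r b - K \<epsilon> * ?r a\<bar> \<le> 9 * K \<epsilon> * e / (2 * \<eta> * l * (l - e) * \<bar>3 - 2 * \<eta> * (l + e)\<bar>)"
    using K by (simp only: right_diff_distrib[symmetric] abs_mult abs_of_pos)
  \<comment> \<open>Strictness is supplied by the ceiling estimate alone.\<close>
  show ?thesis
    unfolding T2_Id_eps[OF \<open>0 < a\<close> \<open>0 < \<epsilon>\<close>] T2_Id_eps[OF \<open>0 < b\<close> \<open>0 < \<epsilon>\<close>]
    using 1 2 3 by linarith
qed

subsection \<open>Perturbation of the low-rank interval\<close>

theorem theorem5p2:
  fixes W_hat W_tilde E :: "real^'n^'n"
    and lam lam_tilde mu :: "nat \<Rightarrow> real"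
    and L :: nat
    and \<epsilon> \<epsilon>' \<alpha> \<eta> T0 T1 T0_tilde T1_tilde :: real
  assumes "symmetric_mat W_hat"
    and "ordered_eigenvalues W_hat lam"
    and "lam CARD('n) \<ge> 0"
    and "symmetric_mat E" and "E \<noteq> 0"
    and "W_tilde = W_hat + E"
    and "ordered_eigenvalues W_tilde lam_tilde"
    and "\<And>i. mu i = max (lam_tilde i) 0"
    and "1 \<le> L" and "L + 1 \<le> CARD('n)"
    and "lam (L + 1) > 0" and "mu (L + 1) > 0"
    and "0 < \<epsilon>" and "\<epsilon> < 1"
    and "0 < \<epsilon>'" and "\<epsilon>' < 1 / 3"
    and "\<alpha> > 0" and "\<eta> > 0"
    and "\<alpha>^2 < \<epsilon>' * min (lam (L + 1)) (mu (L + 1))"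
    and "\<eta> < inverse (4 * Max {1, lam 1, mu 1})"
    and "spectral_conditions \<alpha> \<eta> \<epsilon> \<epsilon>' L lam"
    and "spectral_conditions \<alpha> \<eta> \<epsilon> \<epsilon>' L mu"
    and "T0 = T0_fun \<alpha> \<eta> \<epsilon> L lam"
    and "T1 = T1_fun \<alpha> \<eta> \<epsilon>' (lam (L + 1))"
    and "T0_tilde = T0_fun \<alpha> \<eta> \<epsilon> L mu"
    and "T1_tilde = T1_fun \<alpha> \<eta> \<epsilon>' (mu (L + 1))"
    and "lam (L + 1) - spectral_norm E > \<alpha>^2"
    and "0 < 2 / 3 * \<eta> * (lam (L + 1) + spectral_norm E)"
    and "2 / 3 * \<eta> * (lam (L + 1) + spectral_norm E) < 1"
  shows "\<bar>T1_tilde - T1\<bar> <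
           spectral_norm E / (2 * \<eta> * (lam (L + 1) - spectral_norm E))
           * (1 / (lam (L + 1) - spectral_norm E - \<alpha>^2)
              + \<bar>H \<alpha> (lam (L + 1)) - ln (1 / \<epsilon>' - 1)\<bar> / lam (L + 1))
       \<and> \<bar>T0_tilde - T0\<bar> <
           spectral_norm E / (2 * \<eta> * (lam (L + 1) - spectral_norm E))
           * (1 / (lam (L + 1) - spectral_norm E - \<alpha>^2)
              + \<bar>H \<alpha> (lam (L + 1)) - ln 2\<bar> / lam (L + 1))
           + spectral_norm E / (sqrt 3 * \<alpha>)
             * (1 / (sqrt (lam (L + 1) - spectral_norm E) + sqrt (lam (L + 1))))
           + 9 * K \<epsilon> * spectral_norm E
             / (2 * \<eta> * lam (L + 1) * (lam (L + 1) - spectral_norm E)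
                * \<bar>3 - 2 * \<eta> * (lam (L + 1) + spectral_norm E)\<bar>)
           + 1"
proof -
  let ?e = "spectral_norm E"
  have e: "?e > 0" using assms(5) by (rule spectral_norm_pos)
  have idx: "1 \<le> L" "L \<le> CARD('n)" "1 \<le> L + 1" "L + 1 \<le> CARD('n)"
    using assms by auto
  have S: "lam L \<ge> 2 * (exp 1 + 1) * \<alpha>\<^sup>2" "lam L > lam (L + 1)"
    "mu L \<ge> 2 * (exp 1 + 1) * \<alpha>\<^sup>2" "mu L > mu (L + 1)"
    using assms(21,22) by (auto simp: spectral_conditions_def)
  \<comment> \<open>Both values of \<open>mu\<close> are positive, so the truncation at 0 is
    inactive and Weyl's inequality applies to them.\<close>
  have mu_eq: "mu L = lam_tilde L" "mu (L + 1) = lam_tilde (L + 1)"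
    using assms(8)[of L] assms(8)[of "L + 1"] assms(12) S(4) by linarith+
  have weyl_lam: "\<bar>lam_tilde i - lam i\<bar> \<le> ?e" if "1 \<le> i" "i \<le> CARD('n)" for i
    using weyl[OF assms(1,4,2) assms(7)[unfolded assms(6)] that] .
  have close: "\<bar>mu L - lam L\<bar> \<le> ?e" "\<bar>mu (L + 1) - lam (L + 1)\<bar> \<le> ?e"
    using weyl_lam[OF idx(1,2)] weyl_lam[OF idx(3,4)] by (simp_all only: mu_eq)
  have lam_mono: "lam j \<le> lam i" if "1 \<le> i" "i \<le> j" "j \<le> L" for i j
    using ordered_eigenvalues_antimono[OF assms(2), of i j] that idx by simp
  have mu_mono: "mu j \<le> mu i" if "1 \<le> i" "i \<le> j" "j \<le> L" for i j
    using ordered_eigenvalues_antimono[OF assms(7), of i j] that idx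
    unfolding assms(8) by (intro max.mono) auto
  \<comment> \<open>This gives 2/3 \<eta> x < 1/6 for every eigenvalue involved, well inside the
    range up to 1/2 needed for the last summand of \<open>T2_Id\<close>.\<close>
  have step_size: "\<eta> * x < 1 / 4" if "x \<le> Max {1, lam 1, mu 1}" for x
  proof -
    have "Max {1, lam 1, mu 1} \<ge> 1" by simp
    then have "\<eta> * Max {1, lam 1, mu 1} < 1 / 4"
      using assms(20) by (simp add: inverse_eq_divide pos_less_divide_eq)
    moreover have "\<eta> * x \<le> \<eta> * Max {1, lam 1, mu 1}"
      using that assms(18) by (intro mult_left_mono) auto
    ultimately show ?thesis by linarith
  qed
  have bounds: "lam i \<le> Max {1, lam 1, mu 1}" "mu i \<le> Max {1, lam 1, mu 1}"
    if "1 \<le> i" "i \<le> L" for i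
    using lam_mono[of 1 i] mu_mono[of 1 i] that by (simp_all add: le_max_iff_disj)

  have "\<bar>T1_tilde - T1\<bar> = \<bar>(H \<alpha> (mu (L + 1)) - ln (1 / \<epsilon>' - 1)) / mu (L + 1)
      - (H \<alpha> (lam (L + 1)) - ln (1 / \<epsilon>' - 1)) / lam (L + 1)\<bar> / (2 * \<eta>)"
  proof -
    have "T1_fun \<alpha> \<eta> \<epsilon>' x = (H \<alpha> x - ln (1 / \<epsilon>' - 1)) / x / (2 * \<eta>)" for x
      by (simp add: T1_fun_def mult_ac)
    then show ?thesis
      using assms(18) by (simp only: assms(24,26) diff_divide_distrib[symmetric] abs_divide abs_of_pos zero_less_mult_iff zero_less_numeral simp_thms)
  qed
  also have "\<dots> < ?e / (lam (L + 1) - ?e) * (1 / (lam (L + 1) - ?e - \<alpha>\<^sup>2)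
      + \<bar>H \<alpha> (lam (L + 1)) - ln (1 / \<epsilon>' - 1)\<bar> / lam (L + 1)) / (2 * \<eta>)"
    using assms(18) H_ratio_diff_less[OF assms(17) e close(2) assms(27)]
    by (intro divide_strict_right_mono) auto
  finally have T1: "\<bar>T1_tilde - T1\<bar> < ?e / (2 * \<eta> * (lam (L + 1) - ?e))
      * (1 / (lam (L + 1) - ?e - \<alpha>\<^sup>2) + \<bar>H \<alpha> (lam (L + 1)) - ln (1 / \<epsilon>' - 1)\<bar> / lam (L + 1))"
    by (simp add: mult_ac)

  have T0: "T0 = T2_Id (lam L) (sqrt (lam L) / 8 * \<epsilon>) \<alpha> \<eta>"
    unfolding assms(23)
    using idx(1) lam_mono step_size[OF bounds(1)]
    by (intro T0_fun_eq[OF assms(17,18,13,14,9) _ _ assms(21)]) auto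
  have T0_tilde: "T0_tilde = T2_Id (mu L) (sqrt (mu L) / 8 * \<epsilon>) \<alpha> \<eta>"
    unfolding assms(25)
    using idx(1) mu_mono step_size[OF bounds(2)]
    by (intro T0_fun_eq[OF assms(17,18,13,14,9) _ _ assms(22)]) auto
  have "\<eta> * lam L < 1 / 4" "\<eta> * mu L < 1 / 4"
    using step_size bounds idx(1) by blast+
  \<comment> \<open>The maxima sit at index \<open>L\<close>, while \<open>lam (L + 1)\<close>
    enters as the smaller reference point \<open>l\<close> at which the bound is stated.\<close>
  from T2_Id_diff_less[OF assms(17,18,13,14) e close(1) S(1,3) less_imp_le[OF S(2)] assms(27) this assms(29)] T1
  show ?thesis
    unfolding T0 T0_tilde by (rule conjI[rotated])
qed

end
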